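(* Let $G$ be a finite nonempty simple graph. Then the sum index of $G$ is greater than or equal to its chromatic index, i.e., $s(G)\geq\chi'(G)$.
   Context: Nonempty means having at least one edge. A vertex labeling of a graph $G$ is an injective map $f:V(G)\to\mathbb{Z}$. It induces the edge labeling $f^+:E(G)\to\mathbb{Z}$, $f^+(uv)=f(u)+f(v)$, and $|f^+|$ denotes the number of distinct values $f^+$ takes on $E(G)$. The sum index $s(G)$ is the minimum positive integer $k$ such that there exists a vertex labeling $f$ of $G$ with $|f^+|=k$. The chromatic index $\chi'(G)$ is the minimum number of colors in a proper edge coloring of $G$. *)

theory Defs
  imports "Graph_Theory.Pair_Digraph"
begin

text \<open>
  A finite simple graph is a \<^locale>\<open>pair_graph\<close>: a finite, loop-free, symmetric relation
  \<^const>\<open>parcs\<close> on the vertex set \<^const>\<open>pverts\<close>. Each undirected edge uv appears there as the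
  two arcs (u,v) and (v,u), so labels and colours are attached to the unordered pairs {u,v}.
\<close>

definition uedges :: "'a pair_pre_digraph \<Rightarrow> 'a set set" where
  "uedges G = {{u, v} | u v. (u, v) \<in> parcs G}"

definition vertex_labeling :: "'a pair_pre_digraph \<Rightarrow> ('a \<Rightarrow> int) \<Rightarrow> bool" where
  "vertex_labeling G f \<longleftrightarrow> inj_on f (pverts G)"

text \<open>As there are no loops, this is f(u) + f(v) on an edge {u,v}.\<close>

definition edge_label :: "('a \<Rightarrow> int) \<Rightarrow> 'a set \<Rightarrow> int" where
  "edge_label f e = (\<Sum>v\<in>e. f v)"

definition sum_index :: "'a pair_pre_digraph \<Rightarrow> nat" where
  "sum_index G =
    (LEAST k. k > 0 \<and> (\<exists>f. vertex_labeling G f \<and> card (edge_label f ` uedges G) = k))"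

definition proper_edge_coloring :: "'a pair_pre_digraph \<Rightarrow> ('a set \<Rightarrow> nat) \<Rightarrow> bool" where
  "proper_edge_coloring G c \<longleftrightarrow>
    (\<forall>e\<in>uedges G. \<forall>e'\<in>uedges G. e \<noteq> e' \<and> e \<inter> e' \<noteq> {} \<longrightarrow> c e \<noteq> c e')"

definition chromatic_index :: "'a pair_pre_digraph \<Rightarrow> nat" where
  "chromatic_index G = (LEAST k. \<exists>c. proper_edge_coloring G c \<and> card (c ` uedges G) = k)"

end

theory Submission
  imports Defs "HOL-Library.Nat_Bijection"
begin

text \<open>
  A vertex labeling is in particular a proper edge coloring by the induced edge labels: if two
  distinct edges \<open>uv\<close> and \<open>uw\<close> had equal labels, then \<open>f(u) + f(v) = f(u) + f(w)\<close>, and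
  cancelling \<open>f(u)\<close> would contradict injectivity of \<open>f\<close>. So every number of edge labels realized
  by a vertex labeling is also a number of colors realized by a proper edge coloring. It remains
  to see that the sum index is itself such a number, which needs some vertex labeling with a
  positive number of edge labels: finiteness of the vertex set provides the labeling, and
  nonemptiness of the edge set the positivity.
\<close>

lemma (in pair_graph) uedgeE:
  assumes "e \<in> uedges G" and "u \<in> e"
  obtains v where "e = {u, v}" "u \<noteq> v" "u \<in> pverts G" "v \<in> pverts G"
proof -
  obtain x y where xy: "e = {x, y}" "(x, y) \<in> parcs G"
    using assms(1) unfolding uedges_def by blast
  have "x \<noteq> y" "x \<in> pverts G" "y \<in> pverts G"
    using xy(2) no_loops arc_fst_in_verts arc_snd_in_verts by fastforce+
  then show thesis
    using that xy(1) assms(2) by blast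
qed

lemma (in pair_graph) finite_uedges: "finite (uedges G)"
proof -
  have "uedges G = (\<lambda>(u, v). {u, v}) ` parcs G"
    unfolding uedges_def by auto
  then show ?thesis
    by simp
qed

text \<open>The cancellation argument: the other endpoint of an edge at \<open>u\<close> is determined by its label.\<close>

lemma (in pair_graph) edge_label_eq_adjacent_imp_eq:
  assumes "vertex_labeling G f"
    and "e \<in> uedges G" "e' \<in> uedges G" "u \<in> e" "u \<in> e'"
    and "edge_label f e = edge_label f e'"
  shows "e = e'"
proof -
  obtain v where v: "e = {u, v}" "u \<noteq> v" "v \<in> pverts G"
    using uedgeE assms(2,4) by metis
  obtain w where w: "e' = {u, w}" "u \<noteq> w" "w \<in> pverts G"
    using uedgeE assms(3,5) by metis
  have "f v = f w"
    using assms(6) v w by (simp add: edge_label_def)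
  then have "v = w"
    using assms(1) v(3) w(3) by (auto simp: vertex_labeling_def dest: inj_onD)
  then show ?thesis
    using v w by simp
qed

text \<open>Colors are natural numbers while edge labels are integers, so the labels are transported along
  a bijection from the integers to the naturals; the number of values is unchanged.\<close>

lemma (in pair_graph) proper_edge_coloring_of_vertex_labeling:
  assumes "vertex_labeling G f"
  shows "proper_edge_coloring G (int_encode \<circ> edge_label f)"
  unfolding proper_edge_coloring_def
  using edge_label_eq_adjacent_imp_eq[OF assms] by (auto simp: int_encode_eq)

lemma (in pair_graph) chromatic_index_le_card_edge_labels:
  assumes "vertex_labeling G f"
  shows "chromatic_index G \<le> card (edge_label f ` uedges G)"
proof -
  have "card ((int_encode \<circ> edge_label f) ` uedges G) = card (edge_label f ` uedges G)"
    unfolding image_comp [symmetric] by (rule card_image) (rule inj_int_encode)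
  then show ?thesis
    unfolding chromatic_index_def
    using proper_edge_coloring_of_vertex_labeling[OF assms] by (intro Least_le) blast
qed

lemma (in pair_graph) vertex_labeling_exists: "\<exists>f. vertex_labeling G f"
proof -
  obtain h :: "'a \<Rightarrow> nat" where "inj_on h (pverts G)"
    using finite_imp_inj_to_nat_seg[OF finite_verts] by auto
  then have "inj_on (\<lambda>v. int (h v)) (pverts G)"
    by (simp add: inj_on_def)
  then show ?thesis
    unfolding vertex_labeling_def by blast
qed

text \<open>A least number over an empty set of candidates would be unspecified; for a graph with an edge
  the candidates exist, so the minimum is attained by an actual labeling.\<close>

lemma (in pair_graph) sum_index_attained:
  assumes "uedges G \<noteq> {}"
  obtains f where "vertex_labeling G f" "card (edge_label f ` uedges G) = sum_index G"
proof -
  let ?P = "\<lambda>k. k > 0 \<and> (\<exists>f. vertex_labeling G f \<and> card (edge_label f ` uedges G) = k)"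
  obtain f where f: "vertex_labeling G f"
    using vertex_labeling_exists by blast
  have "?P (card (edge_label f ` uedges G))"
    using f assms finite_uedges by (auto simp: card_gt_0_iff)
  then have "?P (sum_index G)"
    unfolding sum_index_def by (rule LeastI)
  then show thesis
    using that by blast
qed

theorem theorem2p1:
  fixes G :: "'a pair_pre_digraph"
  assumes "pair_graph G"
    and "uedges G \<noteq> {}"
  shows "sum_index G \<ge> chromatic_index G"
proof -
  interpret pair_graph G
    by fact
  obtain f where "vertex_labeling G f" "card (edge_label f ` uedges G) = sum_index G"
    using sum_index_attained[OF assms(2)] .
  then show ?thesis
    using chromatic_index_le_card_edge_labels by metis
qed

end
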